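(* The complex geodesic equation $$\partial_t\mathcal{U}+(\mathcal{U}\cdot\nabla)\mathcal{U}+\frac{ib^2}{2}\nabla^2\mathcal{U}=-\nabla U$$ can be linearised into $$ib^2\,\partial_tG-\frac{b^4}{2}\nabla^2G+UG=0,$$ where $$G=F^*,\qquad \mathcal{U}=ib^2\,\nabla\log G .$$
   Context: $\mathcal{U}$ is a complex vector-valued velocity field depending on position and time (distinct from the scalar potential $U$); it is the complex conjugate $\mathcal{U}=\mathcal{V}^*$ of the complex velocity field $\mathcal{V}=-ib^2\nabla\log F$, where $F$ is the scalar function satisfying the Schrödinger-type equation $ib^2\,\partial_tF=-\frac{b^4}{2}\nabla^2F+UF$. The star denotes complex conjugation. $b$ is a real constant scalar (the diffusion coefficient). $\nabla$ is the spatial gradient and $\nabla^2$ the Laplacian, acting componentwise on vector fields; $\mathcal{U}\cdot\nabla=\sum_j\mathcal{U}_j\partial_{x_j}$, and $\nabla\log G=\nabla G/G$. *)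

theory Defs
  imports "HOL-Analysis.Analysis"
begin

definition partial :: "'n::finite \<Rightarrow> (real^'n \<Rightarrow> 'b::real_normed_vector) \<Rightarrow> real^'n \<Rightarrow> 'b" where
  "partial j f x = vector_derivative (\<lambda>h. f (x + h *\<^sub>R axis j 1)) (at 0)"

definition time_deriv :: "('a \<Rightarrow> real \<Rightarrow> 'b::real_normed_vector) \<Rightarrow> 'a \<Rightarrow> real \<Rightarrow> 'b" where
  "time_deriv f x t = vector_derivative (\<lambda>s. f x s) (at t)"

definition grad :: "(real^'n \<Rightarrow> 'b::real_normed_vector) \<Rightarrow> real^'n \<Rightarrow> 'b^'n" where
  "grad f x = (\<chi> j. partial j f x)"

text \<open>The codomain may be a vector space: for a vector field, \<^term>\<open>partial\<close> and hence the
  Laplacian act componentwise.\<close>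

definition laplacian :: "(real^'n \<Rightarrow> 'b::real_normed_vector) \<Rightarrow> real^'n \<Rightarrow> 'b" where
  "laplacian f x = (\<Sum>j\<in>UNIV. partial j (partial j f) x)"

text \<open>The gradient of the logarithm is the quotient of the gradient by the function, so that no
  branch of the complex logarithm has to be chosen.\<close>

definition grad_log :: "(real^'n \<Rightarrow> complex) \<Rightarrow> real^'n \<Rightarrow> complex^'n" where
  "grad_log f x = (\<chi> j. grad f x $ j / f x)"

text \<open>The operator \<open>w \<cdot> \<nabla>\<close> is complex bilinear: no conjugation of the components of \<open>w\<close>.\<close>

definition advect :: "complex^'n \<Rightarrow> (real^'n \<Rightarrow> complex^'n) \<Rightarrow> real^'n \<Rightarrow> complex^'n" where
  "advect w f x = (\<Sum>j\<in>UNIV. (w $ j) *s partial j f x)"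

definition cnj_vec :: "complex^'n \<Rightarrow> complex^'n" where
  "cnj_vec v = (\<chi> j. cnj (v $ j))"

definition of_real_vec :: "real^'n \<Rightarrow> complex^'n" where
  "of_real_vec v = (\<chi> j. complex_of_real (v $ j))"

text \<open>Intended for open \<open>D\<close>, where it is the usual notion of a \<open>k\<close> times continuously
  differentiable function.\<close>

primrec Ck_on :: "nat \<Rightarrow> ('a::real_normed_vector \<Rightarrow> 'b::real_normed_vector) \<Rightarrow> 'a set \<Rightarrow> bool" where
  "Ck_on 0 f D \<longleftrightarrow> continuous_on D f"
| "Ck_on (Suc k) f D \<longleftrightarrow> (\<forall>p\<in>D. f differentiable (at p)) \<and>
     (\<forall>v. Ck_on k (\<lambda>p. frechet_derivative f (at p) v) D)"

definition schroedinger_on ::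
  "real \<Rightarrow> (real^'n \<Rightarrow> real \<Rightarrow> real) \<Rightarrow> (real^'n) set \<Rightarrow> real set \<Rightarrow> (real^'n \<Rightarrow> real \<Rightarrow> complex) \<Rightarrow> bool"
where
  "schroedinger_on b U \<Omega> T F \<longleftrightarrow> (\<forall>x\<in>\<Omega>. \<forall>t\<in>T.
     \<i> * complex_of_real (b^2) * time_deriv F x t =
       - complex_of_real (b^4 / 2) * laplacian (\<lambda>y. F y t) x + complex_of_real (U x t) * F x t)"

definition linearised_on ::
  "real \<Rightarrow> (real^'n \<Rightarrow> real \<Rightarrow> real) \<Rightarrow> (real^'n) set \<Rightarrow> real set \<Rightarrow> (real^'n \<Rightarrow> real \<Rightarrow> complex) \<Rightarrow> bool"
where
  "linearised_on b U \<Omega> T G \<longleftrightarrow> (\<forall>x\<in>\<Omega>. \<forall>t\<in>T.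
     \<i> * complex_of_real (b^2) * time_deriv G x t
       - complex_of_real (b^4 / 2) * laplacian (\<lambda>y. G y t) x + complex_of_real (U x t) * G x t = 0)"

definition complex_geodesic_on ::
  "real \<Rightarrow> (real^'n \<Rightarrow> real \<Rightarrow> real) \<Rightarrow> (real^'n) set \<Rightarrow> real set \<Rightarrow> (real^'n \<Rightarrow> real \<Rightarrow> complex^'n) \<Rightarrow> bool"
where
  "complex_geodesic_on b U \<Omega> T \<U> \<longleftrightarrow> (\<forall>x\<in>\<Omega>. \<forall>t\<in>T.
     time_deriv \<U> x t + advect (\<U> x t) (\<lambda>y. \<U> y t) x
       + (\<i> * complex_of_real (b^2) / 2) *s laplacian (\<lambda>y. \<U> y t) x
     = - of_real_vec (grad (\<lambda>y. U y t) x))"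

end

theory Submission
  imports Defs
begin

text \<open>Put \<open>w = \<nabla>G / G\<close> and let \<open>R = \<i> b\<^sup>2 \<partial>\<^sub>t G / G - b\<^sup>4 / 2 \<nabla>\<^sup>2 G / G + U\<close> be the linearised equation divided by \<open>G\<close>.
  Since \<open>\<nabla>\<^sup>2 G / G = div w + w \<cdot> w\<close> and \<open>w\<close> is curl free, \<open>\<nabla>R\<close> is the difference of the two sides of the
  geodesic equation for \<open>\<i> b\<^sup>2 w\<close>. So the geodesic equation says that \<open>R\<close> depends on time only, and such
  an \<open>R\<close> is removed by replacing \<open>F\<close> with \<open>exp (\<phi> t) F\<close>, which leaves \<open>w\<close> unchanged and adds
  \<open>\<i> b\<^sup>2 cnj (\<phi>' t)\<close> to \<open>R\<close>.\<close>

section \<open>Directional derivatives and the classes \<open>C\<^sup>k\<close>\<close>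

text \<open>The geodesic equation sees \<open>F\<close> only through its logarithmic gradient, so it
  cannot detect a factor that depends on time alone; this is why the converse can only hold up to a
  gauge. Finding the gauge uses \<open>b \<noteq> 0\<close> to divide by \<open>\<i> * b^2\<close>,
  connectedness of \<open>\<Omega>\<close> to turn a vanishing gradient into constancy on each time
  slice, and the open interval \<open>T\<close> to integrate in time. The gradient of
  \<open>R\<close> requires moving a spatial derivative past a time derivative and past a Laplacian.
  The calculation therefore takes place with directional derivatives on the product space-time,
  where symmetry of second derivatives treats time and space alike; the coordinate derivatives of
  the equations are translated into these. Class \<open>C^3\<close> for \<open>F\<close> makes
  \<open>w\<close> of class \<open>C^2\<close> and \<open>R\<close> of class \<open>C^1\<close>. The
  conjugate of \<open>\<phi>'\<close> appears because the gauge multiplies \<open>F\<close> while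
  \<open>R\<close> is built from \<open>G\<close>:
  \<open>cnj (exp \<phi> * F) = exp (cnj \<phi>) * cnj F\<close>.\<close>

definition dirderiv :: "'a::real_normed_vector \<Rightarrow> ('a \<Rightarrow> 'b::real_normed_vector) \<Rightarrow> 'a \<Rightarrow> 'b" where
  "dirderiv v f p = frechet_derivative f (at p) v"

lemma dirderiv_eq: "(f has_derivative f') (at p) \<Longrightarrow> dirderiv v f p = f' v"
  by (simp add: dirderiv_def flip: frechet_derivative_at)

lemma has_derivative_dirderiv:
  "f differentiable (at p) \<Longrightarrow> (f has_derivative (\<lambda>v. dirderiv v f p)) (at p)"
  by (simp add: dirderiv_def [abs_def] frechet_derivative_works)

text \<open>\<open>frechet_derivative\<close> is a choice among the linear maps that are
  derivatives. On an open set both functions have the same derivatives, so the choice agrees even at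
  points of non-differentiability.\<close>

lemma dirderiv_cong:
  assumes "open D" "p \<in> D" "\<And>q. q \<in> D \<Longrightarrow> f q = g q"
  shows "dirderiv v f p = dirderiv v g p"
proof -
  have "(f has_derivative h) (at p) \<longleftrightarrow> (g has_derivative h) (at p)" for h
    using has_derivative_transform_within_open [OF _ assms(1,2)] assms(3) by metis
  then show ?thesis by (simp add: dirderiv_def frechet_derivative_def)
qed

lemma dirderiv_bounded_linear:
  assumes "bounded_linear L" "f differentiable (at p)"
  shows "dirderiv v (\<lambda>q. L (f q)) p = L (dirderiv v f p)"
  by (rule dirderiv_eq) (rule bounded_linear.has_derivative [OF assms(1) has_derivative_dirderiv [OF assms(2)]])

lemma dirderiv_add:
  assumes "f differentiable (at p)" "g differentiable (at p)"
  shows "dirderiv v (\<lambda>q. f q + g q) p = dirderiv v f p + dirderiv v g p"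
  by (rule dirderiv_eq) (intro derivative_intros has_derivative_dirderiv assms)

lemma dirderiv_sum:
  assumes "\<And>i. i \<in> I \<Longrightarrow> f i differentiable (at p)"
  shows "dirderiv v (\<lambda>q. \<Sum>i\<in>I. f i q) p = (\<Sum>i\<in>I. dirderiv v (f i) p)"
  by (rule dirderiv_eq) (intro derivative_intros has_derivative_dirderiv assms)

lemma dirderiv_mult:
  fixes f g :: "'a::real_normed_vector \<Rightarrow> 'b::real_normed_algebra"
  assumes "f differentiable (at p)" "g differentiable (at p)"
  shows "dirderiv v (\<lambda>q. f q * g q) p = f p * dirderiv v g p + dirderiv v f p * g p"
  by (rule dirderiv_eq) (intro derivative_intros has_derivative_dirderiv assms)

lemma dirderiv_inverse:
  fixes f :: "'a::real_normed_vector \<Rightarrow> 'b::real_normed_field"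
  assumes "f differentiable (at p)" "f p \<noteq> 0"
  shows "dirderiv v (\<lambda>q. inverse (f q)) p = - (dirderiv v f p * (inverse (f p) * inverse (f p)))"
  by (rule trans, rule dirderiv_eq,
      rule Deriv.has_derivative_inverse [OF assms(2) has_derivative_dirderiv [OF assms(1)]])
    (simp add: mult_ac)

lemma dirderiv_divide:
  fixes f g :: "'a::real_normed_vector \<Rightarrow> 'b::real_normed_field"
  assumes "f differentiable (at p)" "g differentiable (at p)" "g p \<noteq> 0"
  shows "dirderiv v (\<lambda>q. f q / g q) p = dirderiv v f p / g p - f p * dirderiv v g p / (g p)\<^sup>2"
proof -
  have "(\<lambda>q. inverse (g q)) differentiable (at p)"
    using assms by (intro derivative_intros)
  with assms show ?thesis
    by (simp add: divide_inverse dirderiv_mult dirderiv_inverse power2_eq_square)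
qed

section \<open>The classes \<open>C^k\<close>: locality, monotonicity and closure under algebraic
  operations\<close>

lemma Ck_on_Suc_iff:
  "Ck_on (Suc k) f D \<longleftrightarrow> (\<forall>p\<in>D. f differentiable (at p)) \<and> (\<forall>v. Ck_on k (dirderiv v f) D)"
  by (simp add: dirderiv_def [abs_def])

lemma Ck_on_dirderiv: "Ck_on (Suc k) f D \<Longrightarrow> Ck_on k (dirderiv v f) D"
  by (simp only: Ck_on_Suc_iff)

text \<open>The differentiation rules hold only at points of \<open>D\<close>, whereas
  \<open>Ck_on\<close> speaks of the derivative as a function on the whole space. The closure proofs
  below use this lemma to replace the derivative by its formula on \<open>D\<close>.\<close>

lemma Ck_on_cong:
  assumes "open D" "\<And>q. q \<in> D \<Longrightarrow> f q = g q" "Ck_on k f D"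
  shows "Ck_on k g D"
  using assms(2,3)
proof (induction k arbitrary: f g)
  case 0
  then show ?case by (simp cong: continuous_on_cong)
next
  case (Suc k)
  have "g differentiable (at p)" if "p \<in> D" for p
    using Suc.prems that has_derivative_transform_within_open [OF _ assms(1) that]
    unfolding Ck_on_Suc_iff differentiable_def by metis
  moreover have "Ck_on k (dirderiv v g) D" for v
    by (rule Suc.IH [of "dirderiv v f"], rule dirderiv_cong [OF assms(1)])
      (use Suc.prems in \<open>auto simp only: Ck_on_Suc_iff\<close>)
  ultimately show ?case by (simp only: Ck_on_Suc_iff) blast
qed

lemma Ck_on_SucD: "Ck_on (Suc k) f D \<Longrightarrow> Ck_on k f D"
proof (induction k arbitrary: f)
  case 0
  then show ?case
    by (auto intro!: continuous_at_imp_continuous_on differentiable_imp_continuous_within)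
next
  case (Suc k)
  then show ?case unfolding Ck_on_Suc_iff [of "Suc k"] Ck_on_Suc_iff [of k f] by blast
qed

lemma Ck_on_mono: "Ck_on k f D \<Longrightarrow> j \<le> k \<Longrightarrow> Ck_on j f D"
proof (induction k)
  case (Suc k)
  then show ?case by (cases "j = Suc k") (auto simp del: Ck_on.simps dest: Ck_on_SucD)
qed simp

lemma Ck_on_const: "Ck_on k (\<lambda>p. c) D"
  by (induction k arbitrary: c) (simp_all)

lemma Ck_on_bounded_linear:
  assumes "open D" "bounded_linear L" "Ck_on k f D"
  shows "Ck_on k (\<lambda>p. L (f p)) D"
  using assms(3)
proof (induction k arbitrary: f)
  case 0
  then show ?case using bounded_linear.continuous_on [OF assms(2)] by simp
next
  case (Suc k)
  have "(\<lambda>p. L (f p)) differentiable (at p)" if "p \<in> D" for p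
    using bounded_linear.has_derivative [OF assms(2)] Suc.prems that
    unfolding Ck_on_Suc_iff differentiable_def by blast
  moreover have "Ck_on k (dirderiv v (\<lambda>p. L (f p))) D" for v
    by (rule Ck_on_cong [OF assms(1) _ Suc.IH [OF Ck_on_dirderiv [OF Suc.prems, of v]]])
      (use Suc.prems in \<open>simp add: dirderiv_bounded_linear [OF assms(2)]\<close>)
  ultimately show ?case by (simp only: Ck_on_Suc_iff) blast
qed

lemma Ck_on_add:
  assumes "open D" "Ck_on k f D" "Ck_on k g D"
  shows "Ck_on k (\<lambda>p. f p + g p) D"
  using assms(2,3)
proof (induction k arbitrary: f g)
  case 0
  then show ?case by (simp add: continuous_on_add)
next
  case (Suc k)
  have "Ck_on k (dirderiv v (\<lambda>p. f p + g p)) D" for v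
    by (rule Ck_on_cong [OF assms(1) _ Suc.IH [OF Suc.prems [THEN Ck_on_dirderiv, of v]]])
      (use Suc.prems in \<open>simp add: dirderiv_add\<close>)
  moreover have "(\<lambda>p. f p + g p) differentiable (at p)" if "p \<in> D" for p
    using Suc.prems that by (auto simp only: Ck_on_Suc_iff intro!: derivative_intros)
  ultimately show ?case by (simp only: Ck_on_Suc_iff) blast
qed

lemma Ck_on_sum:
  assumes "open D" "\<And>i. i \<in> I \<Longrightarrow> Ck_on k (f i) D"
  shows "Ck_on k (\<lambda>p. \<Sum>i\<in>I. f i p) D"
  using assms(2)
  by (induction I rule: infinite_finite_induct) (auto intro: Ck_on_const Ck_on_add [OF assms(1)])

lemma Ck_on_mult:
  fixes f g :: "'a::real_normed_vector \<Rightarrow> 'b::real_normed_algebra"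
  assumes "open D" "Ck_on k f D" "Ck_on k g D"
  shows "Ck_on k (\<lambda>p. f p * g p) D"
  using assms(2,3)
proof (induction k arbitrary: f g)
  case 0
  then show ?case by (simp add: continuous_on_mult)
next
  case (Suc k)
  \<comment> \<open>Each product pairs a derivative, of class \<open>C^k\<close> by definition, with
    an undifferentiated factor lowered from \<open>C^(k+1)\<close> to \<open>C^k\<close>, so the
    induction hypothesis applies to both.\<close>
  have "Ck_on k (\<lambda>p. f p * dirderiv v g p + dirderiv v f p * g p) D" for v
    by (intro Ck_on_add assms(1) Suc.IH Suc.prems [THEN Ck_on_dirderiv] Suc.prems [THEN Ck_on_SucD])
  then have "Ck_on k (dirderiv v (\<lambda>p. f p * g p)) D" for v
    by (rule Ck_on_cong [OF assms(1), rotated]) (use Suc.prems in \<open>simp add: dirderiv_mult\<close>)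
  moreover have "(\<lambda>p. f p * g p) differentiable (at p)" if "p \<in> D" for p
    using Suc.prems that by (auto simp only: Ck_on_Suc_iff intro!: derivative_intros)
  ultimately show ?case by (simp only: Ck_on_Suc_iff) blast
qed

text \<open>The derivative of \<open>1/f\<close> is a polynomial in \<open>1/f\<close> and a
  derivative of \<open>f\<close>. The induction hypothesis is thus needed only for the same
  \<open>f\<close>, one class lower, and the product lemma does the rest.\<close>

lemma Ck_on_inverse:
  fixes f :: "'a::real_normed_vector \<Rightarrow> 'b::real_normed_field"
  assumes "open D" "\<And>p. p \<in> D \<Longrightarrow> f p \<noteq> 0" "Ck_on k f D"
  shows "Ck_on k (\<lambda>p. inverse (f p)) D"
  using assms(3)
proof (induction k)
  case 0
  then show ?case by (simp add: continuous_on_inverse assms(2))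
next
  case (Suc k)
  have "Ck_on k (\<lambda>p. dirderiv v f p * (inverse (f p) * inverse (f p))) D" for v
    by (intro Ck_on_mult assms(1) Suc.IH [OF Ck_on_SucD] Suc.prems Ck_on_dirderiv)
  then have "Ck_on k (\<lambda>p. - (dirderiv v f p * (inverse (f p) * inverse (f p)))) D" for v
    by (rule Ck_on_bounded_linear [OF assms(1) bounded_linear_minus [OF bounded_linear_ident]])
  then have "Ck_on k (dirderiv v (\<lambda>p. inverse (f p))) D" for v
    by (rule Ck_on_cong [OF assms(1), rotated])
      (use Suc.prems assms(2) in \<open>simp add: dirderiv_inverse\<close>)
  moreover have "(\<lambda>p. inverse (f p)) differentiable (at p)" if "p \<in> D" for p
    using Suc.prems that assms(2) by (auto simp only: Ck_on_Suc_iff intro!: derivative_intros)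
  ultimately show ?case by (simp only: Ck_on_Suc_iff) blast
qed

lemma Ck_on_divide:
  fixes f g :: "'a::real_normed_vector \<Rightarrow> 'b::real_normed_field"
  assumes "open D" "\<And>p. p \<in> D \<Longrightarrow> g p \<noteq> 0" "Ck_on k f D" "Ck_on k g D"
  shows "Ck_on k (\<lambda>p. f p / g p) D"
  unfolding divide_inverse by (intro Ck_on_mult Ck_on_inverse assms)

text \<open>A vector is the sum of its components placed on the axes, and each placement is bounded
  linear.\<close>

lemma Ck_on_vec_lambda:
  fixes w :: "'n::finite \<Rightarrow> 'a::real_normed_vector \<Rightarrow> complex"
  assumes "open D" "\<And>i. Ck_on k (w i) D"
  shows "Ck_on k (\<lambda>p. \<chi> i. w i p) D"
proof -
  have lin: "bounded_linear (\<lambda>z. axis i z :: complex^'n)" for i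
    unfolding linear_conv_bounded_linear [symmetric] by (rule linearI) (auto simp: axis_def vec_eq_iff)
  have "(\<lambda>p. \<chi> i. w i p) = (\<lambda>p. \<Sum>i\<in>UNIV. axis i (w i p))"
    by (auto simp: vec_eq_iff axis_def)
  then show ?thesis
    using assms by (simp only:) (intro Ck_on_sum Ck_on_bounded_linear [OF _ lin])
qed

section \<open>Symmetry of second derivatives\<close>

lemma has_real_derivative_along_line:
  fixes f :: "'a::real_normed_vector \<Rightarrow> real"
  assumes "f differentiable (at (c + s *\<^sub>R v))"
  shows "((\<lambda>s. f (c + s *\<^sub>R v)) has_real_derivative dirderiv v f (c + s *\<^sub>R v)) (at s)"
proof -
  have *: "((\<lambda>s. c + s *\<^sub>R v) has_derivative (\<lambda>h. h *\<^sub>R v)) (at s)"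
    by (auto intro!: derivative_eq_intros)
  have "((\<lambda>s. f (c + s *\<^sub>R v)) has_derivative (\<lambda>h. dirderiv (h *\<^sub>R v) f (c + s *\<^sub>R v))) (at s)"
    by (rule has_derivative_compose [OF * has_derivative_dirderiv [OF assms]])
  moreover have "dirderiv (h *\<^sub>R v) f (c + s *\<^sub>R v) = dirderiv v f (c + s *\<^sub>R v) * h" for h
    using linear_frechet_derivative [OF assms] by (simp add: dirderiv_def linear_scale)
  ultimately show ?thesis by (simp add: has_field_derivative_def)
qed

text \<open>The mean value theorem is applied twice: along \<open>v\<close> to the difference of
  \<open>f\<close> on two parallel segments displaced by \<open>h *\<^sub>R w\<close>, then along
  \<open>w\<close> to the derivative so obtained. The left side is symmetric in \<open>v\<close> and
  \<open>w\<close>, but the order of differentiation on the right is not.\<close>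

lemma second_difference_mean_value:
  fixes f :: "'a::real_normed_vector \<Rightarrow> real"
  assumes f: "Ck_on 2 f D" and "h > 0"
    and D: "\<And>s r. s \<in> {0..h} \<Longrightarrow> r \<in> {0..h} \<Longrightarrow> p + s *\<^sub>R v + r *\<^sub>R w \<in> D"
  obtains s r where "0 < s" "s < h" "0 < r" "r < h"
    "f (p + h *\<^sub>R v + h *\<^sub>R w) - f (p + h *\<^sub>R w) - f (p + h *\<^sub>R v) + f p =
      h\<^sup>2 * dirderiv w (dirderiv v f) (p + s *\<^sub>R v + r *\<^sub>R w)"
proof -
  have f1: "f differentiable (at q)" if "q \<in> D" for q
    using f that by (simp add: numeral_2_eq_2)
  have f2: "dirderiv v f differentiable (at q)" if "q \<in> D" for q
    using f that by (simp only: numeral_2_eq_2 Ck_on_Suc_iff)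
  have "((\<lambda>s. f ((p + h *\<^sub>R w) + s *\<^sub>R v) - f (p + s *\<^sub>R v)) has_real_derivative
      dirderiv v f ((p + h *\<^sub>R w) + s *\<^sub>R v) - dirderiv v f (p + s *\<^sub>R v)) (at s)"
    if "0 \<le> s" "s \<le> h" for s
    using D [of s h] D [of s 0] that
    by (intro derivative_intros has_real_derivative_along_line f1) (auto simp: add_ac)
  from MVT2 [OF \<open>h > 0\<close> this] obtain s where s: "0 < s" "s < h"
    and eq1: "f (p + h *\<^sub>R w + h *\<^sub>R v) - f (p + h *\<^sub>R v) - (f (p + h *\<^sub>R w) - f p) =
      h * (dirderiv v f (p + h *\<^sub>R w + s *\<^sub>R v) - dirderiv v f (p + s *\<^sub>R v))"
    by auto
  have "((\<lambda>r. dirderiv v f ((p + s *\<^sub>R v) + r *\<^sub>R w)) has_real_derivative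
      dirderiv w (dirderiv v f) ((p + s *\<^sub>R v) + r *\<^sub>R w)) (at r)"
    if "0 \<le> r" "r \<le> h" for r
    using D [of s r] that s by (intro has_real_derivative_along_line f2) auto
  from MVT2 [OF \<open>h > 0\<close> this] obtain r where r: "0 < r" "r < h"
    and eq2: "dirderiv v f (p + s *\<^sub>R v + h *\<^sub>R w) - dirderiv v f (p + s *\<^sub>R v) =
      h * dirderiv w (dirderiv v f) (p + s *\<^sub>R v + r *\<^sub>R w)"
    by auto
  show thesis
    by (rule that [OF s r]) (use eq1 eq2 in \<open>simp add: add_ac power2_eq_square\<close>)
qed

text \<open>Both mixed derivatives, at suitable points near \<open>p\<close>, equal the same second
  difference divided by the square of \<open>h\<close>. If they differed at \<open>p\<close>,
  continuity would keep each within half the gap of its value there, and they could not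
  coincide.\<close>

lemma dirderiv_commute_real:
  fixes f :: "'a::real_normed_vector \<Rightarrow> real"
  assumes "open D" "p \<in> D" and f: "Ck_on 2 f D"
  shows "dirderiv v (dirderiv w f) p = dirderiv w (dirderiv v f) p"
proof (rule ccontr)
  define A where "A = dirderiv v (dirderiv w f)"
  define B where "B = dirderiv w (dirderiv v f)"
  assume "\<not> ?thesis"
  then have pos: "\<bar>A p - B p\<bar> / 2 > 0" by (simp add: A_def B_def)
  have "continuous_on D A" "continuous_on D B"
    using f unfolding A_def B_def numeral_2_eq_2 Ck_on_Suc_iff by auto
  then have "isCont A p" "isCont B p"
    using assms(1,2) by (auto simp: continuous_on_eq_continuous_at)
  then obtain d1 d2 where d: "d1 > 0" "d2 > 0"
    and A: "\<And>q. dist q p < d1 \<Longrightarrow> dist (A q) (A p) < \<bar>A p - B p\<bar> / 2"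
    and B: "\<And>q. dist q p < d2 \<Longrightarrow> dist (B q) (B p) < \<bar>A p - B p\<bar> / 2"
    using pos unfolding continuous_at_eps_delta by metis
  obtain d3 where d3: "d3 > 0" "ball p d3 \<subseteq> D"
    using assms(1,2) openE by blast
  define d where "d = min d1 (min d2 d3)"
  \<comment> \<open>The summand \<open>1\<close> keeps the denominator positive when
    \<open>v\<close> and \<open>w\<close> both vanish. With this \<open>h\<close> the whole
    parallelogram lies within distance \<open>d\<close> of \<open>p\<close>.\<close>
  define h where "h = d / (2 * (norm v + norm w + 1))"
  have dpos: "d > 0" using d d3 by (simp add: d_def)
  have nn: "norm v + norm w + 1 > 0" by (simp add: add_nonneg_pos)
  have h: "h > 0" using dpos nn by (simp add: h_def)
  have near: "dist (p + s *\<^sub>R v + r *\<^sub>R w) p < d" if "s \<in> {0..h}" "r \<in> {0..h}" for s r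
  proof -
    have "dist (p + s *\<^sub>R v + r *\<^sub>R w) p = norm (s *\<^sub>R v + r *\<^sub>R w)"
      by (simp add: dist_norm)
    also have "\<dots> \<le> s * norm v + r * norm w"
      using that by (intro order_trans [OF norm_triangle_ineq]) auto
    also have "\<dots> \<le> h * norm v + h * norm w"
      using that by (intro add_mono mult_right_mono) auto
    also have "\<dots> < 2 * (h * (norm v + norm w + 1))"
    proof -
      have "0 \<le> h * norm v" "0 \<le> h * norm w" using h by auto
      moreover have "2 * (h * (norm v + norm w + 1)) = 2 * (h * norm v) + 2 * (h * norm w) + 2 * h"
        by (simp add: algebra_simps)
      ultimately show ?thesis using h by linarith
    qed
    also have "\<dots> = d"
    proof -
      have "2 * (d / (2 * N) * N) = d" if "N > 0" for N :: real
        using that by simp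
      from this [OF nn] show ?thesis by (simp only: h_def)
    qed
    finally show ?thesis .
  qed
  have inD: "p + s *\<^sub>R v + r *\<^sub>R w \<in> D" if "s \<in> {0..h}" "r \<in> {0..h}" for s r
    using near [OF that] d3 by (auto simp: d_def dist_commute)
  obtain s r where sr: "0 < s" "s < h" "0 < r" "r < h"
    and eq1: "f (p + h *\<^sub>R v + h *\<^sub>R w) - f (p + h *\<^sub>R w) - f (p + h *\<^sub>R v) + f p =
      h\<^sup>2 * B (p + s *\<^sub>R v + r *\<^sub>R w)"
    using second_difference_mean_value [OF f h, of p v w] inD unfolding B_def by metis
  have inD': "p + s *\<^sub>R w + r *\<^sub>R v \<in> D" if "s \<in> {0..h}" "r \<in> {0..h}" for s r
    using inD [OF that(2,1)] by (simp add: add_ac)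
  obtain s' r' where sr': "0 < s'" "s' < h" "0 < r'" "r' < h"
    and eq2: "f (p + h *\<^sub>R w + h *\<^sub>R v) - f (p + h *\<^sub>R v) - f (p + h *\<^sub>R w) + f p =
      h\<^sup>2 * A (p + s' *\<^sub>R w + r' *\<^sub>R v)"
    using second_difference_mean_value [OF f h, of p w v] inD' unfolding A_def by metis
  have swap: "p + h *\<^sub>R w + h *\<^sub>R v = p + h *\<^sub>R v + h *\<^sub>R w"
    by (simp add: add_ac)
  have "h\<^sup>2 * A (p + s' *\<^sub>R w + r' *\<^sub>R v) = h\<^sup>2 * B (p + s *\<^sub>R v + r *\<^sub>R w)"
    using eq1 eq2 unfolding swap by linarith
  then have "A (p + s' *\<^sub>R w + r' *\<^sub>R v) = B (p + s *\<^sub>R v + r *\<^sub>R w)"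
    using h by simp
  moreover have "dist (B (p + s *\<^sub>R v + r *\<^sub>R w)) (B p) < \<bar>A p - B p\<bar> / 2"
    using near [of s r] sr by (intro B) (simp add: d_def)
  moreover have "dist (A (p + s' *\<^sub>R w + r' *\<^sub>R v)) (A p) < \<bar>A p - B p\<bar> / 2"
    using near [of r' s'] sr' by (intro A) (simp add: d_def add_ac)
  ultimately show False
    by (metis abs_minus_commute dist_commute dist_real_def dist_triangle_half_l less_irrefl)
qed

text \<open>Pairing with a fixed \<open>z\<close> is bounded linear and commutes with
  \<open>dirderiv\<close>, so the real case applies to every \<open>f q \<bullet> z\<close>, and
  inner products separate points. The instance needed is \<open>complex\<close>.\<close>

lemma dirderiv_commute:
  fixes f :: "'a::real_normed_vector \<Rightarrow> 'b::real_inner"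
  assumes "open D" "p \<in> D" and f: "Ck_on 2 f D"
  shows "dirderiv v (dirderiv w f) p = dirderiv w (dirderiv v f) p"
proof -
  have f1: "f differentiable (at q)" and f2: "dirderiv u f differentiable (at q)" if "q \<in> D" for q u
    using f that by (simp_all only: numeral_2_eq_2 Ck_on_Suc_iff)
  have lin: "bounded_linear (\<lambda>y. y \<bullet> z)" for z :: 'b
    by (rule bounded_linear_inner_left)
  have push: "dirderiv u (dirderiv u' (\<lambda>q. f q \<bullet> z)) p = dirderiv u (dirderiv u' f) p \<bullet> z" for u u' z
  proof -
    have "dirderiv u (dirderiv u' (\<lambda>q. f q \<bullet> z)) p = dirderiv u (\<lambda>q. dirderiv u' f q \<bullet> z) p"
      by (rule dirderiv_cong [OF assms(1,2)]) (rule dirderiv_bounded_linear [OF lin f1])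
    also have "\<dots> = dirderiv u (dirderiv u' f) p \<bullet> z"
      by (rule dirderiv_bounded_linear [OF lin f2 [OF assms(2)]])
    finally show ?thesis .
  qed
  have "dirderiv v (dirderiv w f) p \<bullet> z = dirderiv w (dirderiv v f) p \<bullet> z" for z
    using dirderiv_commute_real [OF assms(1,2) Ck_on_bounded_linear [OF assms(1) lin f]]
    by (simp add: push)
  then show ?thesis by (metis vector_eq_rdot)
qed

section \<open>Logarithmic derivatives and the residual\<close>

definition log_deriv :: "'a::real_normed_vector \<Rightarrow> ('a \<Rightarrow> complex) \<Rightarrow> 'a \<Rightarrow> complex" where
  "log_deriv v f p = dirderiv v f p / f p"

lemma Ck_on_log_deriv:
  assumes "open D" "\<And>p. p \<in> D \<Longrightarrow> f p \<noteq> 0" "Ck_on (Suc k) f D"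
  shows "Ck_on k (log_deriv v f) D"
  unfolding log_deriv_def [abs_def]
  by (intro Ck_on_divide assms Ck_on_dirderiv Ck_on_SucD [OF assms(3)])

lemma dirderiv_log_deriv:
  assumes "Ck_on 2 f D" "p \<in> D" "f p \<noteq> 0"
  shows "dirderiv v (log_deriv w f) p =
    dirderiv v (dirderiv w f) p / f p - log_deriv v f p * log_deriv w f p"
proof -
  have "f differentiable (at p)" "dirderiv w f differentiable (at p)"
    using assms(1,2) by (simp_all only: numeral_2_eq_2 Ck_on_Suc_iff)
  then show ?thesis
    using assms(3) unfolding log_deriv_def [abs_def]
    by (simp add: dirderiv_divide power2_eq_square mult.commute)
qed

text \<open>Both terms of \<open>dirderiv_log_deriv\<close> are symmetric in the two directions.
  Besides curl-freeness in space this covers the time direction, which is how the spatial gradient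
  of the time term of the residual becomes a time derivative of \<open>w\<close>.\<close>

lemma dirderiv_log_deriv_commute:
  assumes "open D" "Ck_on 2 f D" "p \<in> D" "f p \<noteq> 0"
  shows "dirderiv v (log_deriv w f) p = dirderiv w (log_deriv v f) p"
  by (simp add: dirderiv_log_deriv [OF assms(2-4)] dirderiv_commute [OF assms(1,3,2), of v w])

abbreviation space_dir :: "'n::finite \<Rightarrow> (real^'n) \<times> real" where
  "space_dir j \<equiv> (axis j 1, 0)"

abbreviation time_dir :: "(real^'n) \<times> real" where
  "time_dir \<equiv> (0, 1)"

text \<open>The linearised equation divided by its unknown \<open>g\<close>.\<close>

definition residual ::
  "complex \<Rightarrow> ((real^'n) \<times> real \<Rightarrow> complex) \<Rightarrow> ((real^'n) \<times> real \<Rightarrow> complex) \<Rightarrow> (real^'n) \<times> real \<Rightarrow> complex"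
where
  "residual \<beta> g V p = \<i> * \<beta> * log_deriv time_dir g p
     - \<beta>\<^sup>2 / 2 * ((\<Sum>j\<in>UNIV. dirderiv (space_dir j) (dirderiv (space_dir j) g) p) / g p) + V p"

lemma Ck_on_residual:
  assumes D: "open D" "\<And>p. p \<in> D \<Longrightarrow> g p \<noteq> 0"
    and g: "Ck_on 3 g D" and V: "Ck_on 1 V D"
  shows "Ck_on 1 (residual \<beta> g V) D"
proof -
  have g3: "Ck_on (Suc (Suc 1)) g D" and g2: "Ck_on (Suc 1) g D" and g1: "Ck_on 1 g D"
    by (rule Ck_on_mono [OF g], simp)+
  \<comment> \<open>The subtraction is written as adding a negative constant multiple, to fit the
    closure lemmas for sums and products. The Laplacian uses up two of the three orders of
    differentiability.\<close>
  have "Ck_on 1 (\<lambda>p. \<i> * \<beta> * log_deriv time_dir g p + (- (\<beta>\<^sup>2 / 2)) *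
      ((\<Sum>j\<in>UNIV. dirderiv (space_dir j) (dirderiv (space_dir j) g) p) / g p) + V p) D"
    by (intro Ck_on_add Ck_on_mult Ck_on_divide Ck_on_sum Ck_on_const Ck_on_log_deriv D V g2 g1
        Ck_on_dirderiv [OF Ck_on_dirderiv [OF g3]])
  then show ?thesis by (simp add: residual_def [abs_def])
qed

text \<open>Obtained from \<open>dirderiv_log_deriv\<close> with both directions equal. In this form
  the residual involves \<open>g\<close> only through logarithmic derivatives, which is what its
  gradient has to be expressed in.\<close>

lemma residual_eq_log_deriv:
  assumes "Ck_on 2 g D" "p \<in> D" "g p \<noteq> 0"
  shows "residual \<beta> g V p = \<i> * \<beta> * log_deriv time_dir g p + (- (\<beta>\<^sup>2 / 2)) *
    (\<Sum>j\<in>UNIV. dirderiv (space_dir j) (log_deriv (space_dir j) g) p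
      + log_deriv (space_dir j) g p * log_deriv (space_dir j) g p) + V p"
  using assms by (simp add: residual_def dirderiv_log_deriv sum_divide_distrib)

lemma dirderiv_linear_combination:
  fixes X Y V :: "'a::real_normed_vector \<Rightarrow> 'b::real_normed_algebra"
  assumes "X differentiable (at p)" "Y differentiable (at p)" "V differentiable (at p)"
  shows "dirderiv v (\<lambda>q. a * X q + b * Y q + V q) p
    = a * dirderiv v X p + b * dirderiv v Y p + dirderiv v V p"
  by (rule dirderiv_eq) (intro derivative_intros has_derivative_dirderiv assms)

lemma dirderiv_residual:
  fixes g V :: "(real^'n) \<times> real \<Rightarrow> complex"
  assumes D: "open D" "\<And>p. p \<in> D \<Longrightarrow> g p \<noteq> 0" and p: "p \<in> D"
    and g: "Ck_on 3 g D" and V: "Ck_on 1 V D"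
  defines "w \<equiv> \<lambda>j. log_deriv (space_dir j) g"
  shows "dirderiv (space_dir k) (residual \<beta> g V) p =
    \<i> * \<beta> * dirderiv time_dir (w k) p
    - \<beta>\<^sup>2 / 2 * (\<Sum>j\<in>UNIV. dirderiv (space_dir j) (dirderiv (space_dir j) (w k)) p)
    - \<beta>\<^sup>2 * (\<Sum>j\<in>UNIV. w j p * dirderiv (space_dir j) (w k) p)
    + dirderiv (space_dir k) V p"
proof -
  have g2: "Ck_on 2 g D" using g by (rule Ck_on_mono) simp
  have g3: "Ck_on (Suc 2) g D" using g by (simp add: numeral_3_eq_3 del: Ck_on.simps)
  have w2: "Ck_on 2 (log_deriv v g) D" for v
    by (rule Ck_on_log_deriv [OF D g3])
  then have w2': "Ck_on (Suc (Suc 0)) (log_deriv v g) D" for v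
    by (simp only: numeral_2_eq_2)
  have diff: "log_deriv v g differentiable (at p)"
    "dirderiv v' (log_deriv v g) differentiable (at p)" for v v'
    using w2' [of v] p by (simp_all only: Ck_on_Suc_iff)
  have diffV: "V differentiable (at p)"
    using V p by simp
  have comm: "dirderiv v (log_deriv v' g) q = dirderiv v' (log_deriv v g) q" if "q \<in> D" for q v v'
    using dirderiv_log_deriv_commute [OF D(1) g2 that D(2) [OF that]] .
  \<comment> \<open>Two different symmetries are combined: the outer derivatives of the
    \<open>C^2\<close> function \<open>w j\<close> are exchanged, then curl-freeness replaces the
    inner \<open>dirderiv (space_dir k) (w j)\<close>, as an identity on all of \<open>D\<close>
    because it is differentiated once more.\<close>
  have third: "dirderiv (space_dir k) (dirderiv (space_dir j) (w j)) p =
      dirderiv (space_dir j) (dirderiv (space_dir j) (w k)) p" for j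
  proof -
    have "dirderiv (space_dir k) (dirderiv (space_dir j) (w j)) p =
        dirderiv (space_dir j) (dirderiv (space_dir k) (w j)) p"
      unfolding w_def by (rule dirderiv_commute [OF D(1) p w2])
    also have "\<dots> = dirderiv (space_dir j) (dirderiv (space_dir j) (w k)) p"
      unfolding w_def by (rule dirderiv_cong [OF D(1) p comm])
    finally show ?thesis .
  qed
  have "dirderiv (space_dir k) (residual \<beta> g V) p =
      dirderiv (space_dir k) (\<lambda>p. \<i> * \<beta> * log_deriv time_dir g p + (- (\<beta>\<^sup>2 / 2)) *
        (\<Sum>j\<in>UNIV. dirderiv (space_dir j) (w j) p + w j p * w j p) + V p) p"
    unfolding w_def by (rule dirderiv_cong [OF D(1) p]) (simp only: residual_eq_log_deriv [OF g2 _ D(2)])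
  also have "\<dots> = \<i> * \<beta> * dirderiv (space_dir k) (log_deriv time_dir g) p + (- (\<beta>\<^sup>2 / 2)) *
        (\<Sum>j\<in>UNIV. dirderiv (space_dir k) (dirderiv (space_dir j) (w j)) p
           + (w j p * dirderiv (space_dir k) (w j) p + dirderiv (space_dir k) (w j) p * w j p))
        + dirderiv (space_dir k) V p"
  proof -
    have "dirderiv (space_dir k) (\<lambda>q. dirderiv (space_dir j) (w j) q + w j q * w j q) p =
        dirderiv (space_dir k) (dirderiv (space_dir j) (w j)) p
           + (w j p * dirderiv (space_dir k) (w j) p + dirderiv (space_dir k) (w j) p * w j p)"
      and dj: "(\<lambda>q. dirderiv (space_dir j) (w j) q + w j q * w j q) differentiable (at p)" for j
      unfolding w_def by (simp_all add: dirderiv_add dirderiv_mult diff)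
    moreover have "(\<lambda>q. \<Sum>j\<in>UNIV. dirderiv (space_dir j) (w j) q + w j q * w j q) differentiable (at p)"
      by (rule differentiable_sum) (auto intro: dj)
    ultimately show ?thesis
      by (simp only: dirderiv_linear_combination [OF diff(1) _ diffV] dirderiv_sum [OF dj])
  qed
  also have "dirderiv (space_dir k) (log_deriv time_dir g) p = dirderiv time_dir (w k) p"
    unfolding w_def by (rule comm [OF p])
  finally have step: "dirderiv (space_dir k) (residual \<beta> g V) p =
      \<i> * \<beta> * dirderiv time_dir (w k) p + (- (\<beta>\<^sup>2 / 2)) *
        (\<Sum>j\<in>UNIV. dirderiv (space_dir k) (dirderiv (space_dir j) (w j)) p
           + (w j p * dirderiv (space_dir k) (w j) p + dirderiv (space_dir k) (w j) p * w j p))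
        + dirderiv (space_dir k) V p" .
  \<comment> \<open>Curl-freeness turns the gradient of \<open>w \<cdot> w\<close> into twice the
    advection term; the factor two cancels the one half in front.\<close>
  have "dirderiv (space_dir k) (w j) p = dirderiv (space_dir j) (w k) p" for j
    unfolding w_def by (rule comm [OF p])
  then show ?thesis
    by (simp add: step third sum.distrib algebra_simps flip: sum_distrib_left)
qed

section \<open>Partial derivatives on space-time\<close>

text \<open>Chain rule along a line in a time slice. It connects \<open>partial\<close>, which sees
  only a slice, with the regularity hypotheses, which concern space-time.\<close>

lemma partial_eq_dirderiv:
  assumes "f differentiable (at (x, t))"
  shows "partial j (\<lambda>y. f (y, t)) x = dirderiv (space_dir j) f (x, t)"
proof -
  have line: "((\<lambda>h. (x + h *\<^sub>R axis j 1, t)) has_derivative (\<lambda>h. h *\<^sub>R space_dir j)) (at 0)"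
    by (auto intro!: derivative_eq_intros)
  have "((\<lambda>h. f (x + h *\<^sub>R axis j 1, t)) has_derivative (\<lambda>h. dirderiv (h *\<^sub>R space_dir j) f (x, t))) (at 0)"
    by (rule has_derivative_compose [OF line]) (use has_derivative_dirderiv [OF assms] in simp)
  moreover have "dirderiv (h *\<^sub>R space_dir j) f (x, t) = h *\<^sub>R dirderiv (space_dir j) f (x, t)" for h
    using linear_frechet_derivative [OF assms] unfolding dirderiv_def by (rule linear_scale)
  ultimately show ?thesis
    unfolding partial_def by (intro vector_derivative_at) (simp only: has_vector_derivative_def)
qed

lemma has_vector_derivative_time:
  assumes "f differentiable (at (x, t))"
  shows "((\<lambda>s. f (x, s)) has_vector_derivative dirderiv time_dir f (x, t)) (at t)"
proof -
  have line: "((\<lambda>s. (x, s)) has_derivative (\<lambda>h. h *\<^sub>R time_dir)) (at t)"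
    by (auto intro!: derivative_eq_intros)
  have "((\<lambda>s. f (x, s)) has_derivative (\<lambda>h. dirderiv (h *\<^sub>R time_dir) f (x, t))) (at t)"
    by (rule has_derivative_compose [OF line has_derivative_dirderiv [OF assms]])
  moreover have "dirderiv (h *\<^sub>R time_dir) f (x, t) = h *\<^sub>R dirderiv time_dir f (x, t)" for h
    using linear_frechet_derivative [OF assms] unfolding dirderiv_def by (rule linear_scale)
  ultimately show ?thesis
    by (simp only: has_vector_derivative_def)
qed

section \<open>Locality of the coordinate operators, and their values on functions of
  space-time\<close>

lemma partial_cong:
  assumes "open \<Omega>" "x \<in> \<Omega>" "\<And>y. y \<in> \<Omega> \<Longrightarrow> f y = g y"
  shows "partial j f x = partial j g x"
proof -
  have "open ((\<lambda>h. x + h *\<^sub>R axis j 1) -` \<Omega>)"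
    by (intro open_vimage assms continuous_intros)
  then have "\<forall>\<^sub>F h in nhds 0. h \<in> (\<lambda>h. x + h *\<^sub>R axis j 1) -` \<Omega>"
    by (rule eventually_nhds_in_open) (simp add: assms)
  then show ?thesis
    unfolding partial_def
    by (intro vector_derivative_cong_eq) (auto elim!: eventually_mono simp: assms(3))
qed

lemma grad_cong:
  assumes "open \<Omega>" "x \<in> \<Omega>" "\<And>y. y \<in> \<Omega> \<Longrightarrow> f y = g y"
  shows "grad f x = grad g x"
  by (simp add: grad_def partial_cong [OF assms])

lemma laplacian_cong:
  assumes "open \<Omega>" "x \<in> \<Omega>" "\<And>y. y \<in> \<Omega> \<Longrightarrow> f y = g y"
  shows "laplacian f x = laplacian g x"
  unfolding laplacian_def
  by (intro sum.cong refl partial_cong [OF assms(1,2)] partial_cong [OF assms(1)] assms(3))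

lemma time_deriv_cong:
  assumes "open T" "t \<in> T" "\<And>s. s \<in> T \<Longrightarrow> f x s = g x s"
  shows "time_deriv f x t = time_deriv g x t"
  unfolding time_deriv_def
  by (intro vector_derivative_cong_eq)
    (use assms in \<open>auto intro: eventually_mono [OF eventually_nhds_in_open]\<close>)

lemma laplacian_eq_dirderiv:
  assumes "open \<Omega>" "x \<in> \<Omega>" "t \<in> T" "Ck_on 2 f (\<Omega> \<times> T)"
  shows "laplacian (\<lambda>y. f (y, t)) x =
    (\<Sum>j\<in>UNIV. dirderiv (space_dir j) (dirderiv (space_dir j) f) (x, t))"
proof -
  have f1: "f differentiable (at (y, t))" and f2: "dirderiv v f differentiable (at (y, t))"
    if "y \<in> \<Omega>" for y v
  proof -
    have "(y, t) \<in> \<Omega> \<times> T" using that assms(3) by simp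
    with assms(4) show "f differentiable (at (y, t))" "dirderiv v f differentiable (at (y, t))"
      by (simp_all only: numeral_2_eq_2 Ck_on_Suc_iff)
  qed
  have "partial j (partial j (\<lambda>y. f (y, t))) x =
      dirderiv (space_dir j) (dirderiv (space_dir j) f) (x, t)" for j
  proof -
    have "partial j (partial j (\<lambda>y. f (y, t))) x =
        partial j (\<lambda>y. dirderiv (space_dir j) f (y, t)) x"
      by (rule partial_cong [OF assms(1,2)]) (rule partial_eq_dirderiv [OF f1])
    also have "\<dots> = dirderiv (space_dir j) (dirderiv (space_dir j) f) (x, t)"
      by (rule partial_eq_dirderiv [OF f2 [OF assms(2)]])
    finally show ?thesis .
  qed
  then show ?thesis by (simp add: laplacian_def)
qed

lemma dirderiv_vec_nth:
  "u differentiable (at p) \<Longrightarrow> dirderiv v u p $ k = dirderiv v (\<lambda>q. u q $ k) p"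
  for u :: "'a::real_normed_vector \<Rightarrow> complex^'n"
  by (rule dirderiv_bounded_linear [OF bounded_linear_vec_nth, symmetric])

lemma partial_mult_left:
  fixes f :: "real^'n \<Rightarrow> complex"
  assumes "f differentiable (at x)"
  shows "partial j (\<lambda>y. c * f y) x = c * partial j f x"
proof -
  have "((\<lambda>h. x + h *\<^sub>R axis j 1) has_derivative (\<lambda>h. h *\<^sub>R axis j 1)) (at 0)"
    by (auto intro!: derivative_eq_intros)
  then have "(\<lambda>h. x + h *\<^sub>R axis j 1) differentiable (at 0)"
    by (rule differentiableI)
  then have "(\<lambda>h. f (x + h *\<^sub>R axis j 1)) differentiable (at 0)"
    using assms differentiable_chain_at [of "\<lambda>h. x + h *\<^sub>R axis j 1" 0 f] by (simp add: o_def)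
  then have "((\<lambda>h. f (x + h *\<^sub>R axis j 1)) has_vector_derivative partial j f x) (at 0)"
    by (simp add: partial_def vector_derivative_works)
  then show ?thesis
    unfolding partial_def [of j "\<lambda>y. c * f y"]
    by (intro vector_derivative_at has_vector_derivative_mult_right)
qed

lemma differentiable_slice:
  assumes "f differentiable (at (x, t))"
  shows "(\<lambda>y. f (y, t)) differentiable (at x)"
proof -
  have "(\<lambda>y. (y, t)) differentiable (at x)"
    by (rule differentiableI) (auto intro!: derivative_eq_intros)
  then show ?thesis
    using assms differentiable_chain_at [of "\<lambda>y. (y, t)" x f] by (simp add: o_def)
qed

text \<open>A gauge factor is constant on each time slice, so it passes through the Laplacian. Only
  the time derivative produces an extra term, in \<open>time_deriv_exp_mult\<close>.\<close>

lemma laplacian_mult_left: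
  fixes f :: "(real^'n) \<times> real \<Rightarrow> complex"
  assumes "open \<Omega>" "x \<in> \<Omega>" "t \<in> T" "Ck_on 2 f (\<Omega> \<times> T)"
  shows "laplacian (\<lambda>y. c * f (y, t)) x = c * laplacian (\<lambda>y. f (y, t)) x"
proof -
  have f1: "f differentiable (at (y, t))" and f2: "dirderiv v f differentiable (at (y, t))"
    if "y \<in> \<Omega>" for y v
  proof -
    have "(y, t) \<in> \<Omega> \<times> T" using that assms(3) by simp
    with assms(4) show "f differentiable (at (y, t))" "dirderiv v f differentiable (at (y, t))"
      by (simp_all only: numeral_2_eq_2 Ck_on_Suc_iff)
  qed
  have partial: "partial j (\<lambda>y. f (y, t)) y = dirderiv (space_dir j) f (y, t)" if "y \<in> \<Omega>" for j y
    by (rule partial_eq_dirderiv [OF f1 [OF that]])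
  have "partial j (partial j (\<lambda>y. c * f (y, t))) x = c * partial j (partial j (\<lambda>y. f (y, t))) x" for j
  proof -
    have "partial j (partial j (\<lambda>y. c * f (y, t))) x =
        partial j (\<lambda>y. c * dirderiv (space_dir j) f (y, t)) x"
      by (rule partial_cong [OF assms(1,2)])
        (simp add: partial_mult_left differentiable_slice f1 partial)
    also have "\<dots> = c * partial j (\<lambda>y. dirderiv (space_dir j) f (y, t)) x"
      by (intro partial_mult_left differentiable_slice f2 assms(2))
    also have "partial j (\<lambda>y. dirderiv (space_dir j) f (y, t)) x = partial j (partial j (\<lambda>y. f (y, t))) x"
      by (rule partial_cong [OF assms(1,2)]) (simp add: partial)
    finally show ?thesis .
  qed
  then show ?thesis by (simp add: laplacian_def sum_distrib_left)
qed

lemma time_deriv_exp_mult: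
  fixes f :: "(real^'n) \<times> real \<Rightarrow> complex"
  assumes "f differentiable (at (x, t))" "(\<phi> has_vector_derivative \<phi>') (at t)"
  shows "time_deriv (\<lambda>x t. exp (\<phi> t) * f (x, t)) x t =
    exp (\<phi> t) * (\<phi>' * f (x, t) + dirderiv time_dir f (x, t))"
proof -
  have "((\<lambda>s. exp (\<phi> s)) has_vector_derivative \<phi>' * exp (\<phi> t)) (at t)"
    using field_vector_diff_chain_at [OF assms(2) DERIV_exp] by (simp add: o_def)
  from has_vector_derivative_mult [OF this has_vector_derivative_time [OF assms(1)]]
  show ?thesis
    unfolding time_deriv_def
    by (intro vector_derivative_at) (simp add: algebra_simps)
qed

section \<open>The gauge freedom\<close>

text \<open>Multiplying the unknown by \<open>exp (\<psi> t)\<close> shifts the residual by \<open>\<i> b\<^sup>2 \<psi>'\<close>.\<close>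

lemma linearised_equation_iff_residual:
  fixes g :: "(real^'n) \<times> real \<Rightarrow> complex" and U :: "real^'n \<Rightarrow> real \<Rightarrow> real"
  assumes \<Omega>: "open \<Omega>" "x \<in> \<Omega>" "t \<in> T" and g: "Ck_on 2 g (\<Omega> \<times> T)" and "g (x, t) \<noteq> 0"
    and \<psi>: "(\<psi> has_vector_derivative \<psi>') (at t)"
  shows "\<i> * complex_of_real (b^2) * time_deriv (\<lambda>x t. exp (\<psi> t) * g (x, t)) x t
       - complex_of_real (b^4 / 2) * laplacian (\<lambda>y. exp (\<psi> t) * g (y, t)) x
       + complex_of_real (U x t) * (exp (\<psi> t) * g (x, t)) = 0
    \<longleftrightarrow> residual (complex_of_real (b^2)) g (\<lambda>(x, t). complex_of_real (U x t)) (x, t)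
        = - (\<i> * complex_of_real (b^2) * \<psi>')"
proof -
  have "g differentiable (at (x, t))"
    using g \<Omega>(2,3) by (simp add: numeral_2_eq_2)
  note time = time_deriv_exp_mult [OF this \<psi>]
  define L where "L = (\<Sum>j\<in>UNIV. dirderiv (space_dir j) (dirderiv (space_dir j) g) (x, t))"
  define B where "B = complex_of_real (b^2)"
  define R where "R = residual B g (\<lambda>(x, t). complex_of_real (U x t)) (x, t)"
  have "\<i> * B * time_deriv (\<lambda>x t. exp (\<psi> t) * g (x, t)) x t
       - complex_of_real (b^4 / 2) * laplacian (\<lambda>y. exp (\<psi> t) * g (y, t)) x
       + complex_of_real (U x t) * (exp (\<psi> t) * g (x, t))
     = exp (\<psi> t) * (\<i> * B * \<psi>' * g (x, t) + (\<i> * B * dirderiv time_dir g (x, t)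
        - B\<^sup>2 / 2 * L + complex_of_real (U x t) * g (x, t)))"
    unfolding time laplacian_mult_left [OF \<Omega> g] laplacian_eq_dirderiv [OF \<Omega> g] L_def [symmetric]
    by (simp add: B_def algebra_simps power2_eq_square power4_eq_xxxx)
  also have "\<i> * B * dirderiv time_dir g (x, t) - B\<^sup>2 / 2 * L + complex_of_real (U x t) * g (x, t) = R * g (x, t)"
    using assms(5) by (simp add: R_def residual_def log_deriv_def L_def field_simps)
  also have "exp (\<psi> t) * (\<i> * B * \<psi>' * g (x, t) + R * g (x, t)) = exp (\<psi> t) * g (x, t) * (\<i> * B * \<psi>' + R)"
    by (simp add: algebra_simps)
  finally show ?thesis
    using assms(5) by (simp add: B_def R_def add_eq_0_iff)
qed

text \<open>Conjugation commutes with the derivatives and fixes the real quantities \<open>b\<close>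
  and \<open>U\<close>; its only effect on the equation is to reverse the sign of
  \<open>\<i>\<close>, which moves the time term to the other side.\<close>

lemma schroedinger_equation_iff_linearised:
  fixes f :: "(real^'n) \<times> real \<Rightarrow> complex" and U :: "real^'n \<Rightarrow> real \<Rightarrow> real"
  assumes \<Omega>: "open \<Omega>" "x \<in> \<Omega>" "t \<in> T" and "open T" and f: "Ck_on 2 f (\<Omega> \<times> T)"
    and \<phi>: "(\<phi> has_vector_derivative \<phi>') (at t)"
  shows "\<i> * complex_of_real (b^2) * time_deriv (\<lambda>x t. exp (\<phi> t) * f (x, t)) x t =
       - complex_of_real (b^4 / 2) * laplacian (\<lambda>y. exp (\<phi> t) * f (y, t)) x
       + complex_of_real (U x t) * (exp (\<phi> t) * f (x, t))
    \<longleftrightarrow> \<i> * complex_of_real (b^2) * time_deriv (\<lambda>x t. cnj (exp (\<phi> t) * f (x, t))) x t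
       - complex_of_real (b^4 / 2) * laplacian (\<lambda>y. cnj (exp (\<phi> t) * f (y, t))) x
       + complex_of_real (U x t) * cnj (exp (\<phi> t) * f (x, t)) = 0"
    (is "?l = ?r \<longleftrightarrow> _")
proof -
  define g where "g = (\<lambda>p. cnj (f p))"
  have DD: "open (\<Omega> \<times> T)" using assms by (simp add: open_Times)
  have g: "Ck_on 2 g (\<Omega> \<times> T)"
    unfolding g_def by (rule Ck_on_bounded_linear [OF DD bounded_linear_cnj f])
  have f1: "f differentiable (at p)" and f2: "dirderiv v f differentiable (at p)"
    and g1: "g differentiable (at p)" if "p \<in> \<Omega> \<times> T" for p v
    using f g that by (simp_all only: numeral_2_eq_2 Ck_on_Suc_iff)
  have p: "(x, t) \<in> \<Omega> \<times> T" using \<Omega> by simp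
  have dg: "dirderiv v g q = cnj (dirderiv v f q)" if "q \<in> \<Omega> \<times> T" for v q
    unfolding g_def by (rule dirderiv_bounded_linear [OF bounded_linear_cnj f1 [OF that]])
  have ddg: "dirderiv v (dirderiv v g) (x, t) = cnj (dirderiv v (dirderiv v f) (x, t))" for v
    using dirderiv_cong [OF DD p dg] dirderiv_bounded_linear [OF bounded_linear_cnj f2 [OF p]]
    by simp
  have cnj_exp: "cnj (exp (\<phi> s) * f (y, s)) = exp (cnj (\<phi> s)) * g (y, s)" for y s
    by (simp add: g_def exp_cnj)
  note timef = time_deriv_exp_mult [OF f1 [OF p] \<phi>]
  note timeg = time_deriv_exp_mult [OF g1 [OF p] has_vector_derivative_cnj [OF \<phi>]]
  have "?l = ?r \<longleftrightarrow> cnj ?l = cnj ?r"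
    by (rule complex_cnj_cancel_iff [symmetric])
  also have "\<dots> \<longleftrightarrow> \<i> * complex_of_real (b^2) * time_deriv (\<lambda>x t. exp (cnj (\<phi> t)) * g (x, t)) x t
       - complex_of_real (b^4 / 2) * laplacian (\<lambda>y. exp (cnj (\<phi> t)) * g (y, t)) x
       + complex_of_real (U x t) * (exp (cnj (\<phi> t)) * g (x, t)) = 0"
    unfolding timef timeg laplacian_mult_left [OF \<Omega> f] laplacian_mult_left [OF \<Omega> g]
      laplacian_eq_dirderiv [OF \<Omega> f] laplacian_eq_dirderiv [OF \<Omega> g] ddg dg [OF p]
    by (simp add: g_def exp_cnj algebra_simps) (auto simp: algebra_simps add_eq_0_iff)
  finally show ?thesis unfolding cnj_exp .
qed

section \<open>Antiderivatives in time and constancy in space\<close>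

lemma antiderivative_on_open_interval:
  fixes h :: "real \<Rightarrow> complex"
  assumes "open T" "is_interval T" "continuous_on T h"
  obtains \<phi> where "\<And>t. t \<in> T \<Longrightarrow> (\<phi> has_vector_derivative h t) (at t)"
proof (cases "T = {}")
  case False
  then obtain t0 where t0: "t0 \<in> T" by blast
  have "((\<lambda>u. LBINT y=t0..u. h y) has_vector_derivative h t) (at t)" if t: "t \<in> T" for t
  proof -
    have "min t0 t \<in> T" "max t0 t \<in> T" using t t0 by (auto simp: min_def max_def)
    \<comment> \<open>The fundamental theorem gives a derivative only within a compact interval.
      Leaving room beyond both \<open>t0\<close> and \<open>t\<close> puts \<open>t\<close> in the
      interior, where this is the full derivative; \<open>min\<close> and \<open>max\<close> cover
      both orders of the two points.\<close>
    then obtain d e where de: "d > 0" "cball (min t0 t) d \<subseteq> T" "e > 0" "cball (max t0 t) e \<subseteq> T"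
      using \<open>open T\<close> open_contains_cball by metis
    define a where "a = min t0 t - d"
    define c where "c = max t0 t + e"
    have "a \<in> T" "c \<in> T"
      using de by (auto simp: a_def c_def dist_real_def subset_iff)
    then have sub: "{a..c} \<subseteq> T"
      by (auto intro: mem_is_interval_1_I [OF assms(2) \<open>a \<in> T\<close> \<open>c \<in> T\<close>])
    have "((\<lambda>u. LBINT y=t0..u. h y) has_vector_derivative h t) (at t within {a..c})"
      by (rule interval_integral_FTC2)
        (use de continuous_on_subset [OF assms(3) sub] in \<open>auto simp: a_def c_def\<close>)
    moreover have "at t within {a..c} = at t"
      by (rule at_within_interior) (use de in \<open>auto simp: a_def c_def\<close>)
    ultimately show ?thesis by (simp only:)
  qed
  then show thesis by (rule that)
qed (use that in blast)

lemma Ck_on_1_antiderivative: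
  fixes \<phi> :: "real \<Rightarrow> 'b::real_normed_vector"
  assumes "\<And>t. t \<in> T \<Longrightarrow> (\<phi> has_vector_derivative h t) (at t)" "continuous_on T h"
  shows "Ck_on 1 \<phi> T"
proof -
  have "\<phi> differentiable (at t)" if "t \<in> T" for t
    using assms(1) [OF that] unfolding has_vector_derivative_def by (rule differentiableI)
  moreover have "continuous_on T (dirderiv v \<phi>)" for v
  proof -
    have "dirderiv v \<phi> t = v *\<^sub>R h t" if "t \<in> T" for t
      using assms(1) [OF that] unfolding has_vector_derivative_def by (rule dirderiv_eq)
    moreover have "continuous_on T (\<lambda>t. v *\<^sub>R h t)"
      by (intro continuous_intros assms(2))
    ultimately show ?thesis by (simp cong: continuous_on_cong)
  qed
  ultimately show ?thesis by (simp add: Ck_on_Suc_iff One_nat_def del: Ck_on.simps(2))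
qed

lemma constant_in_space:
  fixes f :: "(real^'n) \<times> real \<Rightarrow> 'b::banach"
  assumes \<Omega>: "open \<Omega>" "connected \<Omega>"
    and diff: "\<And>x. x \<in> \<Omega> \<Longrightarrow> f differentiable (at (x, t))"
    and zero: "\<And>x k. x \<in> \<Omega> \<Longrightarrow> dirderiv (space_dir k) f (x, t) = 0"
    and "x \<in> \<Omega>" "y \<in> \<Omega>"
  shows "f (x, t) = f (y, t)"
proof (rule has_derivative_zero_unique_connected [OF \<Omega> _ \<open>x \<in> \<Omega>\<close> \<open>y \<in> \<Omega>\<close>, of "\<lambda>x. f (x, t)"])
  fix x assume x: "x \<in> \<Omega>"
  have "((\<lambda>x. (x, t)) has_derivative (\<lambda>h. (h, 0))) (at x)"
    by (auto intro!: derivative_eq_intros)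
  from has_derivative_compose [OF this has_derivative_dirderiv [OF diff [OF x]]]
  have "((\<lambda>x. f (x, t)) has_derivative (\<lambda>h. dirderiv (h, 0) f (x, t))) (at x)" .
  moreover have "dirderiv (h, 0) f (x, t) = 0" for h
  proof -
    have lin: "linear (\<lambda>v. dirderiv v f (x, t))"
      using linear_frechet_derivative [OF diff [OF x]] by (simp add: dirderiv_def)
    \<comment> \<open>Only the coordinate directions are assumed to annihilate \<open>f\<close>, so
      an arbitrary spatial direction is expanded in them.\<close>
    have "(h, 0) = (\<Sum>k\<in>UNIV. (h $ k) *\<^sub>R space_dir k)"
      using basis_expansion [of h] by (simp add: prod_eq_iff fst_sum snd_sum scalar_mult_eq_scaleR)
    then have "dirderiv (h, 0) f (x, t) = dirderiv (\<Sum>k\<in>UNIV. (h $ k) *\<^sub>R space_dir k) f (x, t)"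
      by (simp only:)
    also have "\<dots> = (\<Sum>k\<in>UNIV. (h $ k) *\<^sub>R dirderiv (space_dir k) f (x, t))"
      by (simp only: linear_sum [OF lin] linear_scale [OF lin])
    also have "\<dots> = 0" by (simp add: zero [OF x])
    finally show ?thesis .
  qed
  ultimately show "((\<lambda>x. f (x, t)) has_derivative (\<lambda>h. 0)) (at x)"
    by (simp only:)
qed

section \<open>The geodesic equation\<close>

text \<open>With \<open>\<U> = \<i> * B * w\<close> the advection term carries
  \<open>(\<i> * B)^2 = - B^2\<close> and the Laplacian term
  \<open>(\<i> * B / 2) * (\<i> * B) = - B^2 / 2\<close>. These are the coefficients in
  \<open>dirderiv_residual\<close>, so the left side plus the gradient of \<open>U\<close> is the
  gradient of the residual.\<close>

lemma complex_geodesic_iff_residual: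
  fixes g :: "(real^'n) \<times> real \<Rightarrow> complex" and U :: "real^'n \<Rightarrow> real \<Rightarrow> real"
    and \<U> :: "real^'n \<Rightarrow> real \<Rightarrow> complex^'n"
  assumes \<Omega>: "open \<Omega>" and T: "open T"
    and g: "Ck_on 3 g (\<Omega> \<times> T)" and nz: "\<And>p. p \<in> \<Omega> \<times> T \<Longrightarrow> g p \<noteq> 0"
    and U: "Ck_on 1 (\<lambda>(x, t). U x t) (\<Omega> \<times> T)"
    and \<U>: "\<And>x t. x \<in> \<Omega> \<Longrightarrow> t \<in> T \<Longrightarrow>
      \<U> x t = (\<chi> k. \<i> * complex_of_real (b^2) * log_deriv (space_dir k) g (x, t))"
  shows "complex_geodesic_on b U \<Omega> T \<U> \<longleftrightarrow> (\<forall>x\<in>\<Omega>. \<forall>t\<in>T. \<forall>k.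
    dirderiv (space_dir k) (residual (complex_of_real (b^2)) g (\<lambda>(x, t). complex_of_real (U x t))) (x, t) = 0)"
proof -
  define B where "B = complex_of_real (b^2)"
  define V where "V = (\<lambda>(x, t). complex_of_real (U x t))"
  define w where "w k = log_deriv (space_dir k) g" for k
  define u where "u p = (\<chi> k. \<i> * B * w k p)" for p
  have D: "open (\<Omega> \<times> T)" using \<Omega> T by (rule open_Times)
  have g3: "Ck_on (Suc 2) g (\<Omega> \<times> T)" using g by (simp add: numeral_3_eq_3 del: Ck_on.simps)
  have w2: "Ck_on 2 (w k) (\<Omega> \<times> T)" for k
    unfolding w_def by (rule Ck_on_log_deriv [OF D nz g3])
  have u2: "Ck_on 2 u (\<Omega> \<times> T)"
    unfolding u_def [abs_def] by (intro Ck_on_vec_lambda Ck_on_mult Ck_on_const D w2)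
  have w_diff: "w k differentiable (at p)" "dirderiv v (w k) differentiable (at p)"
    and u_diff: "u differentiable (at p)" "dirderiv v u differentiable (at p)"
    if "p \<in> \<Omega> \<times> T" for v k p
    using w2 [of k] u2 that by (simp_all only: numeral_2_eq_2 Ck_on_Suc_iff)
  have du: "dirderiv v u p $ k = \<i> * B * dirderiv v (w k) p" if "p \<in> \<Omega> \<times> T" for v k p
    using that by (simp add: dirderiv_vec_nth u_diff)
      (simp add: u_def dirderiv_bounded_linear [OF bounded_linear_mult_right] w_diff)
  have ddu: "dirderiv v (dirderiv v' u) p $ k = \<i> * B * dirderiv v (dirderiv v' (w k)) p"
    if p: "p \<in> \<Omega> \<times> T" for v v' k p
  proof -
    have "dirderiv v (dirderiv v' u) p $ k = dirderiv v (\<lambda>q. dirderiv v' u q $ k) p"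
      by (rule dirderiv_vec_nth [OF u_diff(2) [OF p]])
    also have "\<dots> = dirderiv v (\<lambda>q. \<i> * B * dirderiv v' (w k) q) p"
      by (rule dirderiv_cong [OF D p du])
    also have "\<dots> = \<i> * B * dirderiv v (dirderiv v' (w k)) p"
      by (rule dirderiv_bounded_linear [OF bounded_linear_mult_right w_diff(2) [OF p]])
    finally show ?thesis .
  qed
  \<comment> \<open>\<open>\<U>\<close> is prescribed only on \<open>\<Omega> \<times> T\<close>.
    Both sets being open, its derivatives there are those of \<open>u\<close>, whose regularity is
    known.\<close>
  have \<U>u: "\<U> x t = u (x, t)" if "x \<in> \<Omega>" "t \<in> T" for x t
    using \<U> [OF that] by (simp add: u_def w_def B_def)
  have U_diff: "(\<lambda>(x, t). U x t) differentiable (at p)" if "p \<in> \<Omega> \<times> T" for p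
    using U that by (simp only: One_nat_def Ck_on_Suc_iff)
  have "Ck_on 1 (\<lambda>p. complex_of_real ((\<lambda>(x, t). U x t) p)) (\<Omega> \<times> T)"
    by (rule Ck_on_bounded_linear [OF D bounded_linear_of_real U])
  then have V1: "Ck_on 1 V (\<Omega> \<times> T)"
    by (simp add: V_def case_prod_unfold del: Ck_on.simps One_nat_def)
  have "(time_deriv \<U> x t + advect (\<U> x t) (\<lambda>y. \<U> y t) x
       + (\<i> * complex_of_real (b^2) / 2) *s laplacian (\<lambda>y. \<U> y t) x
     = - of_real_vec (grad (\<lambda>y. U y t) x))
     \<longleftrightarrow> (\<forall>k. dirderiv (space_dir k) (residual B g V) (x, t) = 0)" (is "?lhs = - ?rhs \<longleftrightarrow> _")
    if x: "x \<in> \<Omega>" and t: "t \<in> T" for x t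
  proof -
    have p: "(x, t) \<in> \<Omega> \<times> T" using x t by simp
    have time: "time_deriv \<U> x t = dirderiv time_dir u (x, t)"
    proof -
      have "time_deriv \<U> x t = time_deriv (\<lambda>x t. u (x, t)) x t"
        by (rule time_deriv_cong [OF T t]) (rule \<U>u [OF x])
      also have "\<dots> = dirderiv time_dir u (x, t)"
        unfolding time_deriv_def
        by (rule vector_derivative_at [OF has_vector_derivative_time [OF u_diff(1) [OF p]]])
      finally show ?thesis .
    qed
    have space: "partial j (\<lambda>y. \<U> y t) x = dirderiv (space_dir j) u (x, t)" for j
      by (rule trans [OF partial_cong [OF \<Omega> x \<U>u [OF _ t]] partial_eq_dirderiv [OF u_diff(1) [OF p]]])
    have lap: "laplacian (\<lambda>y. \<U> y t) x = (\<Sum>j\<in>UNIV. dirderiv (space_dir j) (dirderiv (space_dir j) u) (x, t))"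
      by (rule trans [OF laplacian_cong [OF \<Omega> x \<U>u [OF _ t]] laplacian_eq_dirderiv [OF \<Omega> x t u2]])
    have gradU: "?rhs $ k = dirderiv (space_dir k) V (x, t)" for k
    proof -
      have "?rhs $ k = complex_of_real (dirderiv (space_dir k) (\<lambda>(x, t). U x t) (x, t))"
        using partial_eq_dirderiv [OF U_diff [OF p]] by (simp add: of_real_vec_def grad_def)
      also have "\<dots> = dirderiv (space_dir k) (\<lambda>p. complex_of_real ((\<lambda>(x, t). U x t) p)) (x, t)"
        by (rule dirderiv_bounded_linear [OF bounded_linear_of_real U_diff [OF p], symmetric])
      also have "(\<lambda>p. complex_of_real ((\<lambda>(x, t). U x t) p)) = V"
        by (simp add: V_def case_prod_unfold)
      finally show ?thesis .
    qed
    have "?lhs $ k + ?rhs $ k = dirderiv (space_dir k) (residual B g V) (x, t)" for k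
    proof -
      have "?lhs $ k = \<i> * B * dirderiv time_dir (w k) (x, t)
          + (\<Sum>j\<in>UNIV. (\<i> * B * w j (x, t)) * (\<i> * B * dirderiv (space_dir j) (w k) (x, t)))
          + \<i> * B / 2 * (\<Sum>j\<in>UNIV. \<i> * B * dirderiv (space_dir j) (dirderiv (space_dir j) (w k)) (x, t))"
        by (simp only: time lap advect_def space vector_add_component vector_smult_component sum_component
            du [OF p] ddu [OF p] \<U>u [OF x t] B_def [symmetric])
          (simp add: u_def)
      also have "(\<Sum>j\<in>UNIV. (\<i> * B * w j (x, t)) * (\<i> * B * dirderiv (space_dir j) (w k) (x, t)))
          = - B\<^sup>2 * (\<Sum>j\<in>UNIV. w j (x, t) * dirderiv (space_dir j) (w k) (x, t))"
        by (simp add: sum_distrib_left power2_eq_square algebra_simps sum_negf)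
      also have "(\<Sum>j\<in>UNIV. \<i> * B * dirderiv (space_dir j) (dirderiv (space_dir j) (w k)) (x, t))
          = \<i> * B * (\<Sum>j\<in>UNIV. dirderiv (space_dir j) (dirderiv (space_dir j) (w k)) (x, t))"
        by (simp add: sum_distrib_left)
      finally have "?lhs $ k + ?rhs $ k = \<i> * B * dirderiv time_dir (w k) (x, t)
          + - B\<^sup>2 * (\<Sum>j\<in>UNIV. w j (x, t) * dirderiv (space_dir j) (w k) (x, t))
          + \<i> * B / 2 * (\<i> * B * (\<Sum>j\<in>UNIV. dirderiv (space_dir j) (dirderiv (space_dir j) (w k)) (x, t)))
          + dirderiv (space_dir k) V (x, t)"
        by (simp only: gradU)
      also have "\<dots> = dirderiv (space_dir k) (residual B g V) (x, t)"
        by (simp add: dirderiv_residual [OF D nz p g V1] w_def power2_eq_square algebra_simps)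
      finally show ?thesis .
    qed
    then have "(\<forall>k. dirderiv (space_dir k) (residual B g V) (x, t) = 0) \<longleftrightarrow> (\<forall>k. ?lhs $ k + ?rhs $ k = 0)"
      by (simp only:)
    also have "\<dots> \<longleftrightarrow> ?lhs = - ?rhs"
      by (simp only: vec_eq_iff vector_uminus_component eq_neg_iff_add_eq_0)
    finally show ?thesis by blast
  qed
  then show ?thesis
    unfolding complex_geodesic_on_def B_def V_def by blast
qed

text \<open>A vanishing spatial gradient makes \<open>R\<close> a function of time, and the gauge
  condition becomes an ordinary differential equation solved by integration. Conversely, the right
  side of the gauge condition does not involve \<open>x\<close>.\<close>

lemma exists_gauge_iff_gradient_zero:
  fixes R :: "(real^'n) \<times> real \<Rightarrow> complex" and c :: complex
  assumes \<Omega>: "open \<Omega>" "connected \<Omega>" and T: "open T" "is_interval T"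
    and R: "Ck_on 1 R (\<Omega> \<times> T)" and c: "c \<noteq> 0"
  shows "(\<forall>x\<in>\<Omega>. \<forall>t\<in>T. \<forall>k. dirderiv (space_dir k) R (x, t) = 0) \<longleftrightarrow>
    (\<exists>\<phi>. Ck_on 1 \<phi> T \<and>
      (\<forall>x\<in>\<Omega>. \<forall>t\<in>T. R (x, t) = - (c * cnj (vector_derivative \<phi> (at t)))))"
    (is "?grad \<longleftrightarrow> (\<exists>\<phi>. _ \<and> ?gauge \<phi>)")
proof
  have diff: "R differentiable (at p)" if "p \<in> \<Omega> \<times> T" for p
    using R that by (simp only: One_nat_def Ck_on_Suc_iff)
  {
    assume ?grad
    then have const: "R (x, t) = R (y, t)" if "x \<in> \<Omega>" "y \<in> \<Omega>" "t \<in> T" for x y t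
      using that diff by (intro constant_in_space [OF \<Omega>]) auto
    show "\<exists>\<phi>. Ck_on 1 \<phi> T \<and> ?gauge \<phi>"
    proof (cases "\<Omega> = {}")
      case True
      then show ?thesis using Ck_on_const by blast
    next
      case False
      then obtain x0 where x0: "x0 \<in> \<Omega>" by blast
      \<comment> \<open>The gauge condition at the base point \<open>x0\<close>, solved for the
        derivative of \<open>\<phi>\<close>; any other point of \<open>\<Omega>\<close> gives the
        same value.\<close>
      define h where "h t = cnj (- R (x0, t) / c)" for t
      have "continuous_on (\<Omega> \<times> T) R"
        using Ck_on_SucD [of 0 R] R by simp
      then have "continuous_on T (\<lambda>t. R (x0, t))"
        by (rule continuous_on_compose2) (use x0 in \<open>auto intro!: continuous_intros\<close>)
      then have cont: "continuous_on T h"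
        unfolding h_def using c by (intro continuous_intros) auto
      obtain \<phi> where \<phi>: "\<And>t. t \<in> T \<Longrightarrow> (\<phi> has_vector_derivative h t) (at t)"
        using antiderivative_on_open_interval [OF T cont] by blast
      have "?gauge \<phi>"
      proof (intro ballI)
        fix x t assume "x \<in> \<Omega>" "t \<in> T"
        then show "R (x, t) = - (c * cnj (vector_derivative \<phi> (at t)))"
          using const [of x x0 t] x0 c by (simp add: vector_derivative_at [OF \<phi>] h_def)
      qed
      then show ?thesis using Ck_on_1_antiderivative [OF \<phi> cont] by blast
    qed
  next
    assume "\<exists>\<phi>. Ck_on 1 \<phi> T \<and> ?gauge \<phi>"
    then obtain \<phi> where gauge: "?gauge \<phi>" by blast
    show ?grad
    proof (intro ballI allI)
      fix x t k assume x: "x \<in> \<Omega>" and t: "t \<in> T"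
      have "dirderiv (space_dir k) R (x, t) = partial k (\<lambda>y. R (y, t)) x"
        using partial_eq_dirderiv [OF diff] x t by simp
      also have "\<dots> = partial k (\<lambda>y. - (c * cnj (vector_derivative \<phi> (at t)))) x"
        by (rule partial_cong [OF \<Omega>(1) x]) (use gauge t in blast)
      also have "\<dots> = 0"
        by (simp add: partial_def)
      finally show "dirderiv (space_dir k) R (x, t) = 0" .
    qed
  }
qed

theorem theorem2:
  fixes b :: real
    and U :: "real^'n \<Rightarrow> real \<Rightarrow> real"
    and \<Omega> :: "(real^'n) set" and T :: "real set"
    and F G :: "real^'n \<Rightarrow> real \<Rightarrow> complex"
    and \<V> \<U> :: "real^'n \<Rightarrow> real \<Rightarrow> complex^'n"
  assumes "b \<noteq> 0"
    and "open \<Omega>" and "connected \<Omega>"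
    and "open T" and "is_interval T"
    and "Ck_on 3 (\<lambda>(x, t). F x t) (\<Omega> \<times> T)"
    and "\<And>x t. x \<in> \<Omega> \<Longrightarrow> t \<in> T \<Longrightarrow> F x t \<noteq> 0"
    and "Ck_on 1 (\<lambda>(x, t). U x t) (\<Omega> \<times> T)"
    and "\<And>x t. x \<in> \<Omega> \<Longrightarrow> t \<in> T \<Longrightarrow>
           \<V> x t = (- \<i> * complex_of_real (b^2)) *s grad_log (\<lambda>y. F y t) x"
    and "\<And>x t. x \<in> \<Omega> \<Longrightarrow> t \<in> T \<Longrightarrow> \<U> x t = cnj_vec (\<V> x t)"
    and "\<And>x t. x \<in> \<Omega> \<Longrightarrow> t \<in> T \<Longrightarrow> G x t = cnj (F x t)"
  shows "(\<forall>x\<in>\<Omega>. \<forall>t\<in>T. \<U> x t = (\<i> * complex_of_real (b^2)) *s grad_log (\<lambda>y. G y t) x)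
    \<and> (schroedinger_on b U \<Omega> T F \<longleftrightarrow> linearised_on b U \<Omega> T G)
    \<and> (linearised_on b U \<Omega> T G \<longrightarrow> complex_geodesic_on b U \<Omega> T \<U>)
    \<and> (complex_geodesic_on b U \<Omega> T \<U> \<longleftrightarrow>
        (\<exists>\<phi> :: real \<Rightarrow> complex. Ck_on 1 \<phi> T \<and>
          (let F' = (\<lambda>x t. exp (\<phi> t) * F x t); G' = (\<lambda>x t. cnj (F' x t)) in
            schroedinger_on b U \<Omega> T F' \<and> linearised_on b U \<Omega> T G' \<and>
            (\<forall>x\<in>\<Omega>. \<forall>t\<in>T. \<U> x t = (\<i> * complex_of_real (b^2)) *s grad_log (\<lambda>y. G' y t) x))))"
proof -
  note \<Omega> = assms(2,3) and T = assms(4,5) and F3 = assms(6) and F_nz = assms(7) and U1 = assms(8)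
    and \<V>_eq = assms(9) and \<U>_eq = assms(10) and G_eq = assms(11)
  define f where "f = (\<lambda>(x, t). F x t)"
  define g where "g p = cnj (f p)" for p
  define B where "B = complex_of_real (b^2)"
  define V where "V = (\<lambda>(x, t). complex_of_real (U x t))"
  define R where "R = residual B g V"
  have D: "open (\<Omega> \<times> T)" using \<Omega> T by (simp add: open_Times)
  have F_f: "F x t = f (x, t)" for x t by (simp add: f_def)
  have G_g: "G x t = g (x, t)" if "x \<in> \<Omega>" "t \<in> T" for x t
    using G_eq [OF that] by (simp add: g_def f_def)
  have f3: "Ck_on 3 f (\<Omega> \<times> T)" using F3 by (simp only: f_def)
  have g3: "Ck_on 3 g (\<Omega> \<times> T)"
    unfolding g_def [abs_def] by (rule Ck_on_bounded_linear [OF D bounded_linear_cnj f3])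
  have f2: "Ck_on 2 f (\<Omega> \<times> T)" and g2: "Ck_on 2 g (\<Omega> \<times> T)"
    by (rule Ck_on_mono [OF f3], simp) (rule Ck_on_mono [OF g3], simp)
  have g_nz: "g p \<noteq> 0" if "p \<in> \<Omega> \<times> T" for p
    using F_nz that by (auto simp: g_def f_def)
  have f_diff: "f differentiable (at p)" and g_diff: "g differentiable (at p)" if "p \<in> \<Omega> \<times> T" for p
    using f2 g2 that by (simp_all only: numeral_2_eq_2 Ck_on_Suc_iff)
  have dg: "dirderiv v g p = cnj (dirderiv v f p)" if "p \<in> \<Omega> \<times> T" for v p
    unfolding g_def [abs_def] by (rule dirderiv_bounded_linear [OF bounded_linear_cnj f_diff [OF that]])
  have "Ck_on 1 (\<lambda>p. complex_of_real ((\<lambda>(x, t). U x t) p)) (\<Omega> \<times> T)"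
    by (rule Ck_on_bounded_linear [OF D bounded_linear_of_real U1])
  then have V1: "Ck_on 1 V (\<Omega> \<times> T)"
    by (simp add: V_def case_prod_unfold del: Ck_on.simps One_nat_def)
  have R1: "Ck_on 1 R (\<Omega> \<times> T)"
    unfolding R_def by (rule Ck_on_residual [OF D g_nz g3 V1])

  have grad_log_g: "grad_log (\<lambda>y. g (y, t)) x $ k = log_deriv (space_dir k) g (x, t)"
    if "x \<in> \<Omega>" "t \<in> T" for x t k
    using that by (simp add: grad_log_def grad_def log_deriv_def partial_eq_dirderiv g_diff)
  \<comment> \<open>Conjugation turns the factor \<open>- \<i>\<close> of \<open>\<V>\<close> into
    \<open>\<i>\<close> and the logarithmic derivatives of \<open>f\<close> into those of
    \<open>g\<close>.\<close>
  have \<U>_log_deriv: "\<U> x t = (\<chi> k. \<i> * complex_of_real (b^2) * log_deriv (space_dir k) g (x, t))"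
    if "x \<in> \<Omega>" "t \<in> T" for x t
    using that
    by (simp add: \<U>_eq \<V>_eq cnj_vec_def grad_log_def grad_def F_f partial_eq_dirderiv f_diff
        log_deriv_def dg vec_eq_iff) (simp add: g_def)
  have \<U>_grad_log: "\<U> x t = (\<i> * complex_of_real (b^2)) *s grad_log (\<lambda>y. g (y, t)) x"
    if "x \<in> \<Omega>" "t \<in> T" for x t
    using that by (simp add: \<U>_log_deriv vec_eq_iff grad_log_g)
  have part1: "\<U> x t = (\<i> * complex_of_real (b^2)) *s grad_log (\<lambda>y. G y t) x"
    if x: "x \<in> \<Omega>" and t: "t \<in> T" for x t
    using grad_cong [OF \<Omega>(1) x G_g [OF _ t]] that
    by (simp add: \<U>_grad_log grad_log_def G_g)

  have gauge_schroedinger: "schroedinger_on b U \<Omega> T (\<lambda>x t. exp (\<phi> t) * F x t) \<longleftrightarrow>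
      linearised_on b U \<Omega> T (\<lambda>x t. cnj (exp (\<phi> t) * F x t))"
    if "\<And>t. t \<in> T \<Longrightarrow> (\<phi> has_vector_derivative \<phi>' t) (at t)" for \<phi> \<phi>'
    unfolding schroedinger_on_def linearised_on_def F_f
    by (intro ball_cong refl schroedinger_equation_iff_linearised [OF \<Omega>(1) _ _ T(1) f2 that])
  have gauge_linearised: "linearised_on b U \<Omega> T (\<lambda>x t. cnj (exp (\<phi> t) * F x t)) \<longleftrightarrow>
      (\<forall>x\<in>\<Omega>. \<forall>t\<in>T. R (x, t) = - (\<i> * B * cnj (\<phi>' t)))"
    if \<phi>: "\<And>t. t \<in> T \<Longrightarrow> (\<phi> has_vector_derivative \<phi>' t) (at t)" for \<phi> \<phi>'
  proof -
    have "cnj (exp (\<phi> t) * F x t) = exp (cnj (\<phi> t)) * g (x, t)" for x t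
      by (simp add: g_def F_f exp_cnj)
    then show ?thesis
      unfolding linearised_on_def R_def B_def V_def
      by (simp only:) (intro ball_cong refl
          linearised_equation_iff_residual [OF \<Omega>(1) _ _ g2 g_nz has_vector_derivative_cnj [OF \<phi>]] SigmaI)
  qed
  \<comment> \<open>The factor \<open>exp 0\<close> presents \<open>G\<close> as the case of the
    trivial gauge, so the two gauge facts above also settle the ungauged equations.\<close>
  have linearised_G: "linearised_on b U \<Omega> T G \<longleftrightarrow> linearised_on b U \<Omega> T (\<lambda>x t. cnj (exp 0 * F x t))"
    unfolding linearised_on_def
  proof (intro ball_cong refl)
    fix x t assume x: "x \<in> \<Omega>" and t: "t \<in> T"
    have eq: "G y s = cnj (exp 0 * F y s)" if "y \<in> \<Omega>" "s \<in> T" for y s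
      using G_eq [OF that] by simp
    have "time_deriv G x t = time_deriv (\<lambda>x t. cnj (exp 0 * F x t)) x t"
      by (rule time_deriv_cong [OF T(1) t]) (rule eq [OF x])
    moreover have "laplacian (\<lambda>y. G y t) x = laplacian (\<lambda>y. cnj (exp 0 * F y t)) x"
      by (rule laplacian_cong [OF \<Omega>(1) x]) (rule eq [OF _ t])
    ultimately show "(\<i> * complex_of_real (b^2) * time_deriv G x t
        - complex_of_real (b^4 / 2) * laplacian (\<lambda>y. G y t) x + complex_of_real (U x t) * G x t = 0) =
      (\<i> * complex_of_real (b^2) * time_deriv (\<lambda>x t. cnj (exp 0 * F x t)) x t
        - complex_of_real (b^4 / 2) * laplacian (\<lambda>y. cnj (exp 0 * F y t)) x
        + complex_of_real (U x t) * cnj (exp 0 * F x t) = 0)"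
      by (simp only: eq [OF x t])
  qed
  have zero: "((\<lambda>t::real. 0 :: complex) has_vector_derivative 0) (at t)" for t
    by (rule has_vector_derivative_const)
  have part2: "schroedinger_on b U \<Omega> T F \<longleftrightarrow> linearised_on b U \<Omega> T G"
    using gauge_schroedinger [OF zero] linearised_G by simp
  have geodesic: "complex_geodesic_on b U \<Omega> T \<U> \<longleftrightarrow>
      (\<exists>\<phi>. Ck_on 1 \<phi> T \<and>
        (\<forall>x\<in>\<Omega>. \<forall>t\<in>T. R (x, t) = - (\<i> * B * cnj (vector_derivative \<phi> (at t)))))"
    using complex_geodesic_iff_residual [OF \<Omega>(1) T(1) g3 g_nz U1 \<U>_log_deriv]
      exists_gauge_iff_gradient_zero [OF \<Omega> T R1, of "\<i> * B"] \<open>b \<noteq> 0\<close>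
    by (simp add: R_def B_def V_def del: Ck_on.simps One_nat_def)
  have part3: "complex_geodesic_on b U \<Omega> T \<U>" if "linearised_on b U \<Omega> T G"
    \<comment> \<open>The linearised equation for \<open>G\<close> says that \<open>R\<close>
      vanishes, so the zero gauge is the witness.\<close>
    using that gauge_linearised [OF zero] Ck_on_const [of 1 "0 :: complex" T]
    unfolding geodesic linearised_G by (intro exI [of _ "\<lambda>t. 0"]) simp

  have gauged: "schroedinger_on b U \<Omega> T (\<lambda>x t. exp (\<phi> t) * F x t) \<and>
      linearised_on b U \<Omega> T (\<lambda>x t. cnj (exp (\<phi> t) * F x t)) \<and>
      (\<forall>x\<in>\<Omega>. \<forall>t\<in>T. \<U> x t =
        (\<i> * complex_of_real (b^2)) *s grad_log (\<lambda>y. cnj (exp (\<phi> t) * F y t)) x) \<longleftrightarrow>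
      (\<forall>x\<in>\<Omega>. \<forall>t\<in>T. R (x, t) = - (\<i> * B * cnj (vector_derivative \<phi> (at t))))"
    if "Ck_on 1 \<phi> T" for \<phi> :: "real \<Rightarrow> complex"
  proof -
    have \<phi>: "(\<phi> has_vector_derivative vector_derivative \<phi> (at t)) (at t)" if "t \<in> T" for t
      using \<open>Ck_on 1 \<phi> T\<close> that by (simp add: vector_derivative_works)
    have "\<U> x t = (\<i> * complex_of_real (b^2)) *s grad_log (\<lambda>y. cnj (exp (\<phi> t) * F y t)) x"
      if "x \<in> \<Omega>" "t \<in> T" for x t
    proof -
      \<comment> \<open>At fixed \<open>t\<close> the exponential is a nonzero constant in
        \<open>y\<close>, so it cancels in the logarithmic gradient: every gauge yields the same
        \<open>\<U>\<close>.\<close>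
      have "(\<lambda>y. cnj (exp (\<phi> t) * F y t)) = (\<lambda>y. cnj (exp (\<phi> t)) * g (y, t))"
        by (simp add: g_def F_f)
      then have "grad_log (\<lambda>y. cnj (exp (\<phi> t) * F y t)) x = grad_log (\<lambda>y. g (y, t)) x"
        using that by (simp add: grad_log_def grad_def partial_mult_left differentiable_slice g_diff)
      then show ?thesis by (simp only: \<U>_grad_log [OF that])
    qed
    then show ?thesis
      using gauge_schroedinger [OF \<phi>] gauge_linearised [OF \<phi>] by blast
  qed
  show ?thesis
    unfolding Let_def using part1 part2 part3 geodesic gauged by blast
qed

end
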